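(* Let $f\in S_{\mu,L}(\mathbb{R}^d)$ with minimizer $x^*$ and $f^*=f(x^* )$, and consider the noisy gradient descent iterations $x_{k+1}=x_k-\alpha(\nabla f(x_k)+w_k)$ with constant stepsize $\alpha\in(0,2/L)$, where $\{w_k\}$ satisfies the noise assumption of the context. Let $\rho_{GD}(\alpha)=\max\{|1-\alpha\mu|,|1-\alpha L|\}$, $\psi_0=\frac L2\|x_0-x^*\|^2$ and $R_{GD}(\alpha)=\frac{L\alpha^2d}{2(1-\rho_{GD}^2(\alpha))}$. Then for all $k\ge0$, $$\mathbb{E}[f(x_k)-f^*]\le\rho_{GD}(\alpha)^{2k}\,\psi_0+\left(1-\rho_{GD}(\alpha)^{2k}\right)\sigma^2R_{GD}(\alpha).$$ As a consequence, $\mathcal{J}\le R_{GD}(\alpha)$, where $\mathcal{J}=\limsup_{k\to\infty}\frac1{\sigma^2}\mathbb{E}[f(x_k)-f^*]$.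
   Context: For $0<\mu\le L$, $S_{\mu,L}(\mathbb{R}^d)$ is the set of continuously differentiable $f:\mathbb{R}^d\to\mathbb{R}$ with $\frac L2\|x-y\|^2\ge f(x)-f(y)-\nabla f(y)^\top(x-y)\ge\frac\mu2\|x-y\|^2$ for all $x,y$. Noise assumption: for some $\sigma>0$ and every $k\ge0$, the random vector $w_k\in\mathbb{R}^d$ has zero mean, is independent of $\{x_i\}_{i=1}^k$, and $\mathbb{E}[w_kw_k^\top]=\sigma^2I_d$; $x_0$ is deterministic. Convention $0^0=1$. *)

theory Defs
  imports "HOL-Probability.Probability"
begin

definition gradient :: "('a::real_inner \<Rightarrow> real) \<Rightarrow> 'a \<Rightarrow> 'a" where
  "gradient f x = (THE D. GDERIV f x :> D)"

lemma gradient_eqI: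
  fixes f :: "'a::real_inner \<Rightarrow> real"
  assumes "GDERIV f x :> D"
  shows "gradient f x = D"
  unfolding gradient_def
proof (rule the_equality)
  fix D' assume "GDERIV f x :> D'"
  with assms have "(\<lambda>h. inner h D) = (\<lambda>h. inner h D')"
    unfolding gderiv_def by (rule has_derivative_unique)
  then have "\<forall>h. inner h D' = inner h D" by (simp add: fun_eq_iff)
  then show "D' = D" by (simp only: vector_eq_ldot)
qed (rule assms)

definition smooth_strongly_convex :: "real \<Rightarrow> real \<Rightarrow> (real^'n \<Rightarrow> real) set" where
  "smooth_strongly_convex \<mu> L =
     {f. (\<forall>x. GDERIV f x :> gradient f x) \<and> continuous_on UNIV (gradient f) \<and>
         (\<forall>x y. L / 2 * (norm (x - y))\<^sup>2 \<ge> f x - f y - gradient f y \<bullet> (x - y) \<and>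
                f x - f y - gradient f y \<bullet> (x - y) \<ge> \<mu> / 2 * (norm (x - y))\<^sup>2)}"

primrec noisy_gd ::
    "(real^'n \<Rightarrow> real) \<Rightarrow> real \<Rightarrow> real^'n \<Rightarrow> (nat \<Rightarrow> 'b \<Rightarrow> real^'n) \<Rightarrow> nat \<Rightarrow> 'b \<Rightarrow> real^'n" where
  "noisy_gd f \<alpha> x0 w 0 = (\<lambda>\<omega>. x0)"
| "noisy_gd f \<alpha> x0 w (Suc k) =
     (\<lambda>\<omega>. noisy_gd f \<alpha> x0 w k \<omega> - \<alpha> *\<^sub>R (gradient f (noisy_gd f \<alpha> x0 w k \<omega>) + w k \<omega>))"

definition outer_self :: "real^'n \<Rightarrow> real^'n^'n" where
  "outer_self v = (columnvector v :: real^1^'n) ** (rowvector v :: real^'n^1)"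

text \<open>Independence of two random variables with possibly different value types; the library's
  \<open>indep_var\<close> requires both to take values in the same type.\<close>

definition indep_rv ::
    "'b measure \<Rightarrow> 'c measure \<Rightarrow> ('b \<Rightarrow> 'c) \<Rightarrow> 'd measure \<Rightarrow> ('b \<Rightarrow> 'd) \<Rightarrow> bool" where
  "indep_rv M N X N' Y \<longleftrightarrow> X \<in> measurable M N \<and> Y \<in> measurable M N' \<and>
     prob_space.indep_set M {X -` A \<inter> space M |A. A \<in> sets N} {Y -` B \<inter> space M |B. B \<in> sets N'}"

text \<open>Integrability is required explicitly because the Bochner integral of a non-integrable
  function is 0. Independence is from the joint vector of the iterates with indices 1 to k
  (the empty family for k = 0), not merely from each iterate separately.\<close>

definition noise_assumption ::
    "'b measure \<Rightarrow> real \<Rightarrow> (nat \<Rightarrow> 'b \<Rightarrow> real^'n) \<Rightarrow> (nat \<Rightarrow> 'b \<Rightarrow> real^'n) \<Rightarrow> bool" where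
  "noise_assumption M \<sigma> w x \<longleftrightarrow> \<sigma> > 0 \<and>
     (\<forall>k. integrable M (w k) \<and> (LINT \<omega>|M. w k \<omega>) = 0 \<and>
          indep_rv M borel (w k)
            (Pi\<^sub>M {1..k} (\<lambda>_. borel)) (\<lambda>\<omega>. \<lambda>i\<in>{1..k}. x i \<omega>) \<and>
          integrable M (\<lambda>\<omega>. outer_self (w k \<omega>)) \<and>
          (LINT \<omega>|M. outer_self (w k \<omega>)) = \<sigma>\<^sup>2 *\<^sub>R mat 1)"

definition rho_GD :: "real \<Rightarrow> real \<Rightarrow> real \<Rightarrow> real" where
  "rho_GD \<mu> L \<alpha> = max \<bar>1 - \<alpha> * \<mu>\<bar> \<bar>1 - \<alpha> * L\<bar>"

definition R_GD :: "nat \<Rightarrow> real \<Rightarrow> real \<Rightarrow> real \<Rightarrow> real" where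
  "R_GD d \<mu> L \<alpha> = L * \<alpha>\<^sup>2 * real d / (2 * (1 - (rho_GD \<mu> L \<alpha>)\<^sup>2))"

definition robustness ::
    "'b measure \<Rightarrow> real \<Rightarrow> (real^'n \<Rightarrow> real) \<Rightarrow> real^'n \<Rightarrow> (nat \<Rightarrow> 'b \<Rightarrow> real^'n) \<Rightarrow> ereal" where
  "robustness M \<sigma> f xs x =
     limsup (\<lambda>k. ereal (1 / \<sigma>\<^sup>2 * (LINT \<omega>|M. f (x k \<omega>) - f xs)))"

end

theory Submission
  imports Defs
begin

text \<open>The gradient step \<open>T x = x - \<alpha> \<nabla>f(x)\<close> is Lipschitz with constant \<open>\<rho>\<close>: writing
  \<open>u = x - y\<close> and \<open>D = \<nabla>f(x) - \<nabla>f(y) - \<mu> u\<close>, the shifted function \<open>f - \<mu>/2 \<parallel>\<cdot>\<parallel>\<^sup>2\<close> is convex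
  and \<open>(L - \<mu>)\<close>-smooth, so \<open>\<parallel>D\<parallel>\<^sup>2 \<le> (L - \<mu>) \<langle>D, u\<rangle>\<close>, and \<open>T x - T y = (1 - \<alpha> \<mu>) u - \<alpha> D\<close>.
  Since \<open>w\<^sub>k\<close> is centred and independent of \<open>x\<^sub>k\<close>, the cross term in \<open>\<parallel>x\<^sub>k\<^sub>+\<^sub>1 - x\<^sup>*\<parallel>\<^sup>2\<close> vanishes in
  expectation, so \<open>e\<^sub>k = E\<parallel>x\<^sub>k - x\<^sup>*\<parallel>\<^sup>2\<close> satisfies \<open>e\<^sub>k\<^sub>+\<^sub>1 \<le> \<rho>\<^sup>2 e\<^sub>k + \<alpha>\<^sup>2 \<sigma>\<^sup>2 d\<close>. Unrolling this
  recursion and using \<open>f(x) - f(x\<^sup>*) \<le> L/2 \<parallel>x - x\<^sup>*\<parallel>\<^sup>2\<close> gives the bound.\<close>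

section \<open>Smoothness and strong convexity: contraction of the gradient step\<close>

lemma
  assumes "f \<in> smooth_strongly_convex \<mu> L"
  shows smooth_strongly_convex_upper:
      "f x - f y - gradient f y \<bullet> (x - y) \<le> L / 2 * (norm (x - y))\<^sup>2"
    and smooth_strongly_convex_lower:
      "\<mu> / 2 * (norm (x - y))\<^sup>2 \<le> f x - f y - gradient f y \<bullet> (x - y)"
    and smooth_strongly_convex_gderiv: "GDERIV f x :> gradient f x"
    and smooth_strongly_convex_gradient_measurable: "gradient f \<in> borel_measurable borel"
    and smooth_strongly_convex_measurable: "f \<in> borel_measurable borel"
proof -
  have GD: "\<And>x. GDERIV f x :> gradient f x" and "continuous_on UNIV (gradient f)"
    using assms by (auto simp: smooth_strongly_convex_def)
  then show "gradient f \<in> borel_measurable borel" "GDERIV f x :> gradient f x"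
    by (auto intro: borel_measurable_continuous_onI)
  have "continuous_on UNIV f"
    using GD by (auto simp: gderiv_def continuous_on_eq_continuous_at
        intro: has_derivative_continuous)
  then show "f \<in> borel_measurable borel"
    by (rule borel_measurable_continuous_onI)
qed (use assms in \<open>auto simp: smooth_strongly_convex_def\<close>)

lemma gderiv_is_arg_min_eq_0:
  fixes f :: "'a::real_inner \<Rightarrow> real"
  assumes "GDERIV f x :> D" and "is_arg_min f (\<lambda>_. True) x"
  shows "D = 0"
proof -
  have "(\<lambda>h. h \<bullet> D) = (\<lambda>h. 0)"
    using assms by (intro has_derivative_local_min[where f = f and x = x])
      (auto simp: gderiv_def is_arg_min_linorder)
  then show ?thesis
    by (metis inner_eq_zero_iff)
qed

text \<open>Compare the upper bound of \<open>f\<close> at \<open>z = x - t D\<close> from \<open>x\<close> with the lower bound from \<open>y\<close>;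
  adding the same inequality with \<open>x\<close> and \<open>y\<close> exchanged removes the values of \<open>f\<close>.\<close>

lemma smooth_strongly_convex_shifted_step:
  assumes f: "f \<in> smooth_strongly_convex \<mu> L"
    and D: "D = gradient f x - gradient f y - \<mu> *\<^sub>R (x - y)"
  shows "(2 * t - (L - \<mu>) * t\<^sup>2) * (norm D)\<^sup>2 \<le> D \<bullet> (x - y)"
proof -
  have half: "f y - f x + gradient f y \<bullet> (x - y) + \<mu> / 2 * (norm (x - y))\<^sup>2
      \<le> ((L - \<mu>) / 2 * t\<^sup>2 - t) * (norm D)\<^sup>2"
    if D: "D = gradient f x - gradient f y - \<mu> *\<^sub>R (x - y)" for x y D
  proof -
    define z where "z = x - t *\<^sub>R D"
    \<comment> \<open>Once \<open>gradient f x\<close> is eliminated, the terms in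
      \<open>D \<bullet> (x - y)\<close> and \<open>D \<bullet> gradient f y\<close> cancel when the
      two bounds at \<open>z\<close> are combined, which leaves only the multiple of
      \<open>(norm D)\<^sup>2\<close>.\<close>
    have g: "gradient f x = D + gradient f y + \<mu> *\<^sub>R (x - y)"
      using D by simp
    have "f z - f x - gradient f x \<bullet> (z - x) \<le> L / 2 * (norm (z - x))\<^sup>2"
      "\<mu> / 2 * (norm (z - y))\<^sup>2 \<le> f z - f y - gradient f y \<bullet> (z - y)"
      using smooth_strongly_convex_upper[OF f] smooth_strongly_convex_lower[OF f] by blast+
    then show ?thesis
      unfolding z_def g power2_norm_eq_inner
      by (simp add: algebra_simps inner_commute power2_eq_square add_divide_distrib diff_divide_distrib)
  qed
  have "- D = gradient f y - gradient f x - \<mu> *\<^sub>R (y - x)"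
    by (simp add: D algebra_simps)
  from half[OF this] have half': "f x - f y - gradient f x \<bullet> (x - y) + \<mu> / 2 * (norm (x - y))\<^sup>2
      \<le> ((L - \<mu>) / 2 * t\<^sup>2 - t) * (norm D)\<^sup>2"
    by (simp add: norm_minus_commute inner_diff_right)
  have "D \<bullet> (x - y) = gradient f x \<bullet> (x - y) - gradient f y \<bullet> (x - y) - \<mu> * (norm (x - y))\<^sup>2"
    by (simp add: D power2_norm_eq_inner inner_diff_left)
  with half[OF D] half' show ?thesis
    by (simp add: algebra_simps)
qed

text \<open>For \<mu> < L, the choice \<open>t = 1 / (L - \<mu>)\<close> maximizes the factor
  \<open>2 * t - (L - \<mu>) * t\<^sup>2\<close> of the shifted step. For \<mu> = L that factor is
  linear in \<open>t\<close>, so it is unbounded and forces \<open>D = 0\<close>.\<close>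

lemma smooth_strongly_convex_cocoercive:
  assumes f: "f \<in> smooth_strongly_convex \<mu> L" and "\<mu> \<le> L"
    and D: "D = gradient f x - gradient f y - \<mu> *\<^sub>R (x - y)"
  shows "(norm D)\<^sup>2 \<le> (L - \<mu>) * (D \<bullet> (x - y))"
proof (cases "\<mu> = L")
  case True
  let ?p = "D \<bullet> (x - y)"
  have step: "2 * t * (norm D)\<^sup>2 \<le> ?p" for t
    using smooth_strongly_convex_shifted_step[OF f D, of t] True by simp
  have "D = 0"
  proof (rule ccontr)
    assume "D \<noteq> 0"
    \<comment> \<open>The first choice of \<open>t\<close> turns the left side into
      \<open>2 * ?p\<close>, so \<open>?p\<close> cannot be positive; \<open>t = 1\<close> makes it
      positive.\<close>
    then have "2 * ?p \<le> ?p" "2 * (norm D)\<^sup>2 \<le> ?p" "(norm D)\<^sup>2 > 0"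
      using step[of "?p / (norm D)\<^sup>2"] step[of 1] by simp_all
    then show False by simp
  qed
  then show ?thesis by simp
next
  case False
  with \<open>\<mu> \<le> L\<close> have pos: "L - \<mu> > 0" by simp
  then have "2 * (1 / (L - \<mu>)) - (L - \<mu>) * (1 / (L - \<mu>))\<^sup>2 = 1 / (L - \<mu>)"
    by (simp add: power2_eq_square)
  then have "1 / (L - \<mu>) * (norm D)\<^sup>2 \<le> D \<bullet> (x - y)"
    using smooth_strongly_convex_shifted_step[OF f D, of "1 / (L - \<mu>)"] by simp
  then show ?thesis
    using pos by (simp add: pos_divide_le_eq mult.commute)
qed

text \<open>After cocoercivity replaces \<open>(norm D)\<^sup>2\<close>, the bound is affine in
  \<open>?p\<close>, which ranges over the interval from 0 to
  \<open>(L - \<mu>) * (norm u)\<^sup>2\<close>. Its maximum is at an endpoint: the left one gives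
  the factor \<open>(1 - \<alpha> * \<mu>)\<^sup>2\<close>, the right one
  \<open>(1 - \<alpha> * L)\<^sup>2\<close>, and \<open>rho_GD\<close> dominates both.\<close>

lemma gradient_step_contraction:
  assumes f: "f \<in> smooth_strongly_convex \<mu> L" and "\<mu> \<le> L" and "0 \<le> \<alpha>"
  shows "(norm ((x - \<alpha> *\<^sub>R gradient f x) - (y - \<alpha> *\<^sub>R gradient f y)))\<^sup>2
    \<le> (rho_GD \<mu> L \<alpha>)\<^sup>2 * (norm (x - y))\<^sup>2"
proof -
  define u where "u = x - y"
  define D where "D = gradient f x - gradient f y - \<mu> *\<^sub>R (x - y)"
  let ?p = "D \<bullet> u"
  have coc: "(norm D)\<^sup>2 \<le> (L - \<mu>) * ?p"
    unfolding u_def by (rule smooth_strongly_convex_cocoercive[OF f \<open>\<mu> \<le> L\<close> D_def])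
  \<comment> \<open>Adding the quadratic bound for \<open>x\<close>, \<open>y\<close> to the one
    with the points exchanged cancels the values of \<open>f\<close>; the lower bounds give this
    estimate and the upper bounds the next.\<close>
  have p_nonneg: "0 \<le> ?p"
    using smooth_strongly_convex_lower[OF f, of x y] smooth_strongly_convex_lower[OF f, of y x]
    by (simp add: D_def u_def power2_norm_eq_inner algebra_simps inner_commute)
  have p_le: "?p \<le> (L - \<mu>) * (norm u)\<^sup>2"
    using smooth_strongly_convex_upper[OF f, of x y] smooth_strongly_convex_upper[OF f, of y x]
    by (simp add: D_def u_def power2_norm_eq_inner algebra_simps inner_commute)
  have step: "(x - \<alpha> *\<^sub>R gradient f x) - (y - \<alpha> *\<^sub>R gradient f y) = (1 - \<alpha> * \<mu>) *\<^sub>R u - \<alpha> *\<^sub>R D"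
    by (simp add: u_def D_def algebra_simps)
  have "(norm ((x - \<alpha> *\<^sub>R gradient f x) - (y - \<alpha> *\<^sub>R gradient f y)))\<^sup>2
      = (1 - \<alpha> * \<mu>)\<^sup>2 * (norm u)\<^sup>2 - 2 * \<alpha> * (1 - \<alpha> * \<mu>) * ?p + \<alpha>\<^sup>2 * (norm D)\<^sup>2"
    unfolding step power2_norm_eq_inner
    by (simp add: inner_diff_left inner_diff_right inner_commute power2_eq_square algebra_simps)
  also have "\<dots> \<le> (1 - \<alpha> * \<mu>)\<^sup>2 * (norm u)\<^sup>2 + \<alpha> * (\<alpha> * (L + \<mu>) - 2) * ?p"
    using mult_left_mono[OF coc, of "\<alpha>\<^sup>2"] by (simp add: power2_eq_square algebra_simps)
  also have "\<dots> \<le> (rho_GD \<mu> L \<alpha>)\<^sup>2 * (norm u)\<^sup>2"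
  proof (cases "\<alpha> * (L + \<mu>) - 2 \<le> 0")
    case True
    have "(1 - \<alpha> * \<mu>)\<^sup>2 \<le> (rho_GD \<mu> L \<alpha>)\<^sup>2"
      by (rule power2_le_iff_abs_le[THEN iffD2]) (auto simp: rho_GD_def)
    then have "(1 - \<alpha> * \<mu>)\<^sup>2 * (norm u)\<^sup>2 \<le> (rho_GD \<mu> L \<alpha>)\<^sup>2 * (norm u)\<^sup>2"
      by (simp add: mult_right_mono)
    moreover have "\<alpha> * (\<alpha> * (L + \<mu>) - 2) * ?p \<le> 0"
      using True \<open>0 \<le> \<alpha>\<close> p_nonneg by (simp add: mult_nonneg_nonpos mult_nonpos_nonneg)
    ultimately show ?thesis by linarith
  next
    case False
    then have "\<alpha> * (\<alpha> * (L + \<mu>) - 2) * ?p \<le> \<alpha> * (\<alpha> * (L + \<mu>) - 2) * ((L - \<mu>) * (norm u)\<^sup>2)"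
      using p_le \<open>0 \<le> \<alpha>\<close> by (intro mult_left_mono) auto
    then have "(1 - \<alpha> * \<mu>)\<^sup>2 * (norm u)\<^sup>2 + \<alpha> * (\<alpha> * (L + \<mu>) - 2) * ?p
        \<le> (1 - \<alpha> * L)\<^sup>2 * (norm u)\<^sup>2"
      by (simp add: power2_eq_square algebra_simps)
    also have "(1 - \<alpha> * L)\<^sup>2 \<le> (rho_GD \<mu> L \<alpha>)\<^sup>2"
      by (rule power2_le_iff_abs_le[THEN iffD2]) (auto simp: rho_GD_def)
    then have "(1 - \<alpha> * L)\<^sup>2 * (norm u)\<^sup>2 \<le> (rho_GD \<mu> L \<alpha>)\<^sup>2 * (norm u)\<^sup>2"
      by (simp add: mult_right_mono)
    finally show ?thesis .
  qed
  finally show ?thesis by (simp add: u_def)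
qed

lemma rho_GD_bounds:
  assumes "0 < \<mu>" "\<mu> \<le> L" "\<alpha> \<in> {0<..<2 / L}"
  shows "0 \<le> rho_GD \<mu> L \<alpha>" and "rho_GD \<mu> L \<alpha> < 1"
proof -
  have "0 < \<alpha> * \<mu>" "\<alpha> * \<mu> \<le> \<alpha> * L" "\<alpha> * L < 2"
    using assms by (auto simp: field_simps)
  then show "0 \<le> rho_GD \<mu> L \<alpha>" and "rho_GD \<mu> L \<alpha> < 1"
    by (auto simp: rho_GD_def)
qed

section \<open>Moments of the noise and independence\<close>

lemma outer_self_component: "outer_self v $ i $ j = v $ i * v $ j"
  by (simp add: outer_self_def columnvector_def rowvector_def matrix_matrix_mult_def)

text \<open>The squared norm is the trace of \<open>outer_self\<close>, so both claims follow from
  the diagonal entries of the covariance.\<close>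

lemma
  fixes W :: "'b \<Rightarrow> real^'n"
  assumes int: "integrable M (\<lambda>\<omega>. outer_self (W \<omega>))"
    and cov: "(LINT \<omega>|M. outer_self (W \<omega>)) = c *\<^sub>R mat 1"
  shows integrable_norm_square_outer_self: "integrable M (\<lambda>\<omega>. (norm (W \<omega>))\<^sup>2)"
    and integral_norm_square_outer_self: "(LINT \<omega>|M. (norm (W \<omega>))\<^sup>2) = c * real CARD('n)"
proof -
  have bl: "bounded_linear (\<lambda>A::real^'n^'n. A $ i $ i)" for i
    by (intro bounded_linear_compose[OF bounded_linear_vec_nth] bounded_linear_vec_nth)
  have norm_eq: "(norm (W \<omega>))\<^sup>2 = (\<Sum>i\<in>UNIV. outer_self (W \<omega>) $ i $ i)" for \<omega>
    by (simp add: power2_norm_eq_inner inner_vec_def outer_self_component)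
  have diag: "integrable M (\<lambda>\<omega>. outer_self (W \<omega>) $ i $ i)" for i
    by (rule integrable_bounded_linear[OF bl int])
  have "(LINT \<omega>|M. outer_self (W \<omega>) $ i $ i) = c" for i
    using integral_bounded_linear[OF bl int] by (simp add: cov mat_def)
  then show "(LINT \<omega>|M. (norm (W \<omega>))\<^sup>2) = c * real CARD('n)"
    unfolding norm_eq using diag by (subst Bochner_Integration.integral_sum) auto
  show "integrable M (\<lambda>\<omega>. (norm (W \<omega>))\<^sup>2)"
    unfolding norm_eq using diag by (intro Bochner_Integration.integrable_sum)
qed

text \<open>This passes from the noise and the tuple of iterates, whose types differ, to real
  functions of them, where expectations of products factor. The preimage families are
  intersection-stable, so independence extends to the generated sigma-algebras, and composition only
  shrinks these.\<close>

lemma (in prob_space) indep_rv_compose_indep_var: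
  assumes ind: "indep_rv M N X N' Y"
    and g: "g \<in> measurable N S" and h: "h \<in> measurable N' T"
  shows "indep_var S (g \<circ> X) T (h \<circ> Y)"
proof -
  have [measurable]: "X \<in> measurable M N" "Y \<in> measurable M N'"
    and set: "indep_set {X -` A \<inter> space M |A. A \<in> sets N} {Y -` B \<inter> space M |B. B \<in> sets N'}"
    using ind by (auto simp: indep_rv_def)
  note [measurable] = g h
  have stable: "Int_stable {Z -` A \<inter> space M |A. A \<in> sets K}"
    for Z :: "'a \<Rightarrow> 'z" and K :: "'z measure"
    by (rule Int_stableI) (auto, metis sets.Int vimage_Int inf_assoc inf_left_commute inf.idem)
  have sub: "{(k \<circ> Z) -` A \<inter> space M |A. A \<in> sets K'} \<subseteq> {Z -` A \<inter> space M |A. A \<in> sets K}"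
    if k: "k \<in> measurable K K'" and Z: "Z \<in> measurable M K" for k Z K K'
  proof safe
    fix A assume "A \<in> sets K'"
    have "(k \<circ> Z) -` A \<inter> space M = Z -` (k -` A \<inter> space K) \<inter> space M"
      using measurable_space[OF Z] by auto
    then show "\<exists>B. (k \<circ> Z) -` A \<inter> space M = Z -` B \<inter> space M \<and> B \<in> sets K"
      using measurable_sets[OF k \<open>A \<in> sets K'\<close>] by blast
  qed
  have "indep_set (sigma_sets (space M) {X -` A \<inter> space M |A. A \<in> sets N})
    (sigma_sets (space M) {Y -` B \<inter> space M |B. B \<in> sets N'})"
    by (intro indep_set_sigma_sets set stable)
  then have "indep_set (sigma_sets (space M) {(g \<circ> X) -` A \<inter> space M |A. A \<in> sets S})
    (sigma_sets (space M) {(h \<circ> Y) -` B \<inter> space M |B. B \<in> sets T})"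
    unfolding indep_set_def
    by (rule indep_sets_mono_sets)
      (simp split: bool.split add: sigma_sets_mono'[OF sub] g h)
  then show ?thesis
    by (auto simp: indep_var_eq)
qed

text \<open>The inner product is a sum of coordinate products, so independence is needed only for
  coordinates of equal index. It yields the integrability of each product as well as its zero
  mean.\<close>

lemma (in prob_space) indep_centred_inner:
  fixes V W :: "'a \<Rightarrow> real^'n"
  assumes V: "integrable M V" and W: "integrable M W" and "(LINT \<omega>|M. W \<omega>) = 0"
    and ind: "\<And>i. indep_var borel (\<lambda>\<omega>. W \<omega> $ i) borel (\<lambda>\<omega>. V \<omega> $ i)"
  shows "integrable M (\<lambda>\<omega>. V \<omega> \<bullet> W \<omega>)" and "(LINT \<omega>|M. V \<omega> \<bullet> W \<omega>) = 0"
proof -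
  have comp: "integrable M (\<lambda>\<omega>. Z \<omega> $ i)" "(LINT \<omega>|M. Z \<omega> $ i) = (LINT \<omega>|M. Z \<omega>) $ i"
    if "integrable M Z" for Z :: "'a \<Rightarrow> real^'n" and i
    using that bounded_linear_vec_nth
    by (auto intro: integrable_bounded_linear integral_bounded_linear)
  have "integrable M (\<lambda>\<omega>. W \<omega> $ i * V \<omega> $ i)" "(LINT \<omega>|M. W \<omega> $ i * V \<omega> $ i) = 0" for i
    using indep_var_integrable[OF ind comp(1)[OF W] comp(1)[OF V]]
      indep_var_lebesgue_integral[OF ind comp(1)[OF W] comp(1)[OF V]] comp(2)[OF W] assms(3)
    by auto
  then show "integrable M (\<lambda>\<omega>. V \<omega> \<bullet> W \<omega>)" and "(LINT \<omega>|M. V \<omega> \<bullet> W \<omega>) = 0"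
    by (simp_all add: inner_vec_def mult.commute[of "V _ $ _"])
qed

section \<open>The recursion for the mean squared error and the final bound\<close>

lemma noisy_gd_second_moment:
  fixes f :: "real^'n \<Rightarrow> real" and w x :: "nat \<Rightarrow> 'b \<Rightarrow> real^'n"
  assumes "prob_space M"
    and f: "f \<in> smooth_strongly_convex \<mu> L" and "\<mu> \<le> L" and "0 \<le> \<alpha>"
    and min: "gradient f xs = 0"
    and x: "x = noisy_gd f \<alpha> x0 w"
    and noise: "noise_assumption M \<sigma> w x"
    and meas: "x k \<in> borel_measurable M"
    and int: "integrable M (\<lambda>\<omega>. (norm (x k \<omega> - xs))\<^sup>2)"
  shows "integrable M (\<lambda>\<omega>. (norm (x (Suc k) \<omega> - xs))\<^sup>2)"
    and "(LINT \<omega>|M. (norm (x (Suc k) \<omega> - xs))\<^sup>2)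
      \<le> (rho_GD \<mu> L \<alpha>)\<^sup>2 * (LINT \<omega>|M. (norm (x k \<omega> - xs))\<^sup>2) + \<alpha>\<^sup>2 * (\<sigma>\<^sup>2 * real CARD('n))"
proof -
  interpret prob_space M by fact
  \<comment> \<open>Since \<open>gradient f xs = 0\<close>, the point \<open>xs\<close> is fixed by
    the noiseless step, so \<open>T y\<close> is the error after that step from
    \<open>y\<close>.\<close>
  define T where "T y = y - \<alpha> *\<^sub>R gradient f y - xs" for y
  define V where "V \<omega> = T (x k \<omega>)" for \<omega>
  let ?\<rho> = "rho_GD \<mu> L \<alpha>"
  have w_int: "integrable M (w k)" and w_mean: "(LINT \<omega>|M. w k \<omega>) = 0"
    and ind: "indep_rv M borel (w k) (Pi\<^sub>M {1..k} (\<lambda>_. borel)) (\<lambda>\<omega>. \<lambda>i\<in>{1..k}. x i \<omega>)"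
    and w_sq: "integrable M (\<lambda>\<omega>. (norm (w k \<omega>))\<^sup>2)"
      "(LINT \<omega>|M. (norm (w k \<omega>))\<^sup>2) = \<sigma>\<^sup>2 * real CARD('n)"
    using noise integrable_norm_square_outer_self[of M "w k"]
      integral_norm_square_outer_self[of M "w k"]
    by (auto simp: noise_assumption_def)
  note [measurable] = smooth_strongly_convex_gradient_measurable[OF f] meas
  have T_meas [measurable]: "T \<in> borel_measurable borel"
    unfolding T_def by measurable
  have V_meas [measurable]: "V \<in> borel_measurable M"
    unfolding V_def by measurable
  have V_le: "(norm (V \<omega>))\<^sup>2 \<le> ?\<rho>\<^sup>2 * (norm (x k \<omega> - xs))\<^sup>2" for \<omega>
    using gradient_step_contraction[OF f \<open>\<mu> \<le> L\<close> \<open>0 \<le> \<alpha>\<close>, of "x k \<omega>" xs]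
    by (simp add: V_def T_def min)
  have V_sq: "integrable M (\<lambda>\<omega>. (norm (V \<omega>))\<^sup>2)"
    by (rule Bochner_Integration.integrable_bound[OF integrable_mult_right[OF int, of "?\<rho>\<^sup>2"]])
      (use V_le in \<open>auto simp: abs_mult\<close>)
  \<comment> \<open>On a probability space square integrability implies integrability, which the
    cross term requires.\<close>
  have V_int: "integrable M V"
    using square_integrable_imp_integrable[of "\<lambda>\<omega>. norm (V \<omega>)"] V_sq
    by (simp add: integrable_norm_iff)
  \<comment> \<open>For \<open>k = 0\<close> the tuple of iterates is empty and does not contain
    \<open>x 0\<close>, but \<open>V\<close> is then constant. For positive \<open>k\<close>,
    \<open>V\<close> is a function of the coordinate \<open>k\<close> of the tuple.\<close>
  have "indep_var borel (\<lambda>\<omega>. w k \<omega> $ i) borel (\<lambda>\<omega>. V \<omega> $ i)" for i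
  proof (cases "k = 0")
    case True
    then have V_const: "(\<lambda>\<omega>. V \<omega> $ i) = (\<lambda>_. T x0 $ i) \<circ> (\<lambda>\<omega>. \<lambda>i\<in>{1..k}. x i \<omega>)"
      by (auto simp: V_def x)
    show ?thesis
      unfolding V_const
      using indep_rv_compose_indep_var[OF ind, of "\<lambda>v. v $ i" borel "\<lambda>_. T x0 $ i" borel]
      by (simp add: comp_def)
  next
    case False
    then have V_proj: "(\<lambda>\<omega>. V \<omega> $ i) = (\<lambda>z. T (z k) $ i) \<circ> (\<lambda>\<omega>. \<lambda>i\<in>{1..k}. x i \<omega>)"
      by (auto simp: V_def)
    have "(\<lambda>z. z k) \<in> measurable (Pi\<^sub>M {1..k} (\<lambda>_. borel :: (real^'n) measure)) borel"
      using False by (intro measurable_component_singleton) auto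
    then have "(\<lambda>z. T (z k) $ i) \<in> measurable (Pi\<^sub>M {1..k} (\<lambda>_. borel)) borel"
      by (rule measurable_compose) (rule measurable_compose[OF T_meas], simp)
    then show ?thesis
      unfolding V_proj
      using indep_rv_compose_indep_var[OF ind, of "\<lambda>v. v $ i" borel "\<lambda>z. T (z k) $ i" borel]
      by (simp add: comp_def)
  qed
  note cross = indep_centred_inner[OF V_int w_int w_mean this]
  have expand: "(norm (x (Suc k) \<omega> - xs))\<^sup>2
      = (norm (V \<omega>))\<^sup>2 - 2 * \<alpha> * (V \<omega> \<bullet> w k \<omega>) + \<alpha>\<^sup>2 * (norm (w k \<omega>))\<^sup>2" for \<omega>
  proof -
    have step: "x (Suc k) \<omega> - xs = V \<omega> - \<alpha> *\<^sub>R w k \<omega>"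
      by (simp add: V_def T_def x algebra_simps)
    show ?thesis
      unfolding step power2_norm_eq_inner
      by (simp add: inner_diff_left inner_diff_right inner_commute power2_eq_square algebra_simps)
  qed
  show "integrable M (\<lambda>\<omega>. (norm (x (Suc k) \<omega> - xs))\<^sup>2)"
    unfolding expand using V_sq cross w_sq by auto
  have "(LINT \<omega>|M. (norm (x (Suc k) \<omega> - xs))\<^sup>2)
      = (LINT \<omega>|M. (norm (V \<omega>))\<^sup>2) + \<alpha>\<^sup>2 * (\<sigma>\<^sup>2 * real CARD('n))"
    unfolding expand using V_sq cross w_sq by simp
  also have "(LINT \<omega>|M. (norm (V \<omega>))\<^sup>2) \<le> (LINT \<omega>|M. ?\<rho>\<^sup>2 * (norm (x k \<omega> - xs))\<^sup>2)"
    using V_sq int V_le by (intro integral_mono) auto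
  finally show "(LINT \<omega>|M. (norm (x (Suc k) \<omega> - xs))\<^sup>2)
      \<le> ?\<rho>\<^sup>2 * (LINT \<omega>|M. (norm (x k \<omega> - xs))\<^sup>2) + \<alpha>\<^sup>2 * (\<sigma>\<^sup>2 * real CARD('n))"
    by simp
qed

text \<open>The number \<open>c / (1 - q)\<close> is the fixed point of the affine map
  \<open>q * e + c\<close>; the distance to it is multiplied by \<open>q\<close> in each
  step.\<close>

lemma affine_recursion_bound:
  fixes e :: "nat \<Rightarrow> real"
  assumes "0 \<le> q" "q < 1" and step: "\<And>k. e (Suc k) \<le> q * e k + c"
  shows "e k \<le> q ^ k * e 0 + (1 - q ^ k) * (c / (1 - q))"
proof (induction k)
  case (Suc k)
  have "e (Suc k) \<le> q * (q ^ k * e 0 + (1 - q ^ k) * (c / (1 - q))) + c"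
    using step[of k] mult_left_mono[OF Suc \<open>0 \<le> q\<close>] by linarith
  also have "\<dots> = q ^ Suc k * e 0 + (1 - q ^ Suc k) * (c / (1 - q))"
    using \<open>q < 1\<close> by (simp add: divide_simps) (simp add: algebra_simps)
  finally show ?case .
qed simp

theorem corollary4p4:
  fixes f :: "real^'n \<Rightarrow> real" and xs x0 :: "real^'n"
    and \<mu> L \<alpha> \<sigma> :: real
    and M :: "'b measure" and w x :: "nat \<Rightarrow> 'b \<Rightarrow> real^'n"
  assumes "0 < \<mu>" and "\<mu> \<le> L"
    and "f \<in> smooth_strongly_convex \<mu> L"
    and "is_arg_min f (\<lambda>_. True) xs"
    and "\<alpha> \<in> {0<..<2 / L}"
    and "prob_space M"
    and "x = noisy_gd f \<alpha> x0 w"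
    and "noise_assumption M \<sigma> w x"
  shows "(\<forall>k. integrable M (\<lambda>\<omega>. f (x k \<omega>) - f xs) \<and>
           (LINT \<omega>|M. f (x k \<omega>) - f xs)
             \<le> (rho_GD \<mu> L \<alpha>) ^ (2 * k) * (L / 2 * (norm (x0 - xs))\<^sup>2)
               + (1 - (rho_GD \<mu> L \<alpha>) ^ (2 * k)) * \<sigma>\<^sup>2 * R_GD CARD('n) \<mu> L \<alpha>)
         \<and> robustness M \<sigma> f xs x \<le> ereal (R_GD CARD('n) \<mu> L \<alpha>)"
proof -
  interpret prob_space M by fact
  note f = assms(3) and x = assms(7) and noise = assms(8)
  define \<rho> where "\<rho> = rho_GD \<mu> L \<alpha>"
  define R where "R = R_GD CARD('n) \<mu> L \<alpha>"
  define e where "e k = (LINT \<omega>|M. (norm (x k \<omega> - xs))\<^sup>2)" for k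
  have "0 < \<alpha>" "0 < L" "0 < \<sigma>"
    using assms(1,2,5) noise by (auto simp: noise_assumption_def)
  have \<rho>: "0 \<le> \<rho>" "\<rho> < 1"
    using rho_GD_bounds[OF assms(1,2,5)] by (auto simp: \<rho>_def)
  then have \<rho>2: "0 \<le> \<rho>\<^sup>2" "\<rho>\<^sup>2 < 1"
    by (auto simp: power_less_one_iff)
  have min: "gradient f xs = 0"
    by (rule gderiv_is_arg_min_eq_0[OF smooth_strongly_convex_gderiv[OF f] assms(4)])
  note [measurable] = smooth_strongly_convex_gradient_measurable[OF f]
    smooth_strongly_convex_measurable[OF f]
  have w_meas [measurable]: "w k \<in> borel_measurable M" for k
    using noise by (auto simp: noise_assumption_def intro!: borel_measurable_integrable)
  have x_meas [measurable]: "x k \<in> borel_measurable M" for k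
    unfolding x by (induction k) simp_all
  note moment = noisy_gd_second_moment[OF \<open>prob_space M\<close> f \<open>\<mu> \<le> L\<close> less_imp_le[OF \<open>0 < \<alpha>\<close>]
      min x noise x_meas]
  have sq: "integrable M (\<lambda>\<omega>. (norm (x k \<omega> - xs))\<^sup>2)" for k
  proof (induction k)
    case 0
    show ?case by (simp add: x)
  qed (rule moment(1))
  have "e (Suc k) \<le> \<rho>\<^sup>2 * e k + \<alpha>\<^sup>2 * (\<sigma>\<^sup>2 * real CARD('n))" for k
    unfolding e_def \<rho>_def by (rule moment(2)[OF sq])
  note e_bound = affine_recursion_bound[of "\<rho>\<^sup>2" e, OF \<rho>2 this]
  have e_0: "e 0 = (norm (x0 - xs))\<^sup>2"
    by (simp add: e_def x prob_space)
  have gap_nonneg: "0 \<le> f y - f xs" for y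
    using assms(4) by (simp add: is_arg_min_linorder)
  have gap_le: "f y - f xs \<le> L / 2 * (norm (y - xs))\<^sup>2" for y
    using smooth_strongly_convex_upper[OF f, of y xs] by (simp add: min)
  \<comment> \<open>The gap lies between 0 and a multiple of the integrable squared error.\<close>
  have gap_int: "integrable M (\<lambda>\<omega>. f (x k \<omega>) - f xs)" for k
    by (rule Bochner_Integration.integrable_bound[OF integrable_mult_right[OF sq[of k], of "L / 2"]])
      (use gap_nonneg gap_le \<open>0 < L\<close> in \<open>auto simp: abs_mult\<close>)
  have bound: "(LINT \<omega>|M. f (x k \<omega>) - f xs)
      \<le> \<rho> ^ (2 * k) * (L / 2 * (norm (x0 - xs))\<^sup>2) + (1 - \<rho> ^ (2 * k)) * \<sigma>\<^sup>2 * R" for k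
  proof -
    have "(LINT \<omega>|M. f (x k \<omega>) - f xs) \<le> (LINT \<omega>|M. L / 2 * (norm (x k \<omega> - xs))\<^sup>2)"
      by (intro integral_mono gap_int gap_le integrable_mult_right sq)
    also have "\<dots> = L / 2 * e k"
      by (simp add: e_def)
    also have "\<dots> \<le> L / 2 * ((\<rho>\<^sup>2) ^ k * e 0
        + (1 - (\<rho>\<^sup>2) ^ k) * (\<alpha>\<^sup>2 * (\<sigma>\<^sup>2 * real CARD('n)) / (1 - \<rho>\<^sup>2)))"
      using e_bound[of k] \<open>0 < L\<close> by (intro mult_left_mono) auto
    \<comment> \<open>The fixed point of the recursion, multiplied by \<open>L / 2\<close>, is
      \<open>\<sigma>\<^sup>2 * R\<close>.\<close>
    also have "\<dots> = \<rho> ^ (2 * k) * (L / 2 * (norm (x0 - xs))\<^sup>2) + (1 - \<rho> ^ (2 * k)) * \<sigma>\<^sup>2 * R"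
      using \<rho>2 by (simp add: R_def R_GD_def \<rho>_def[symmetric] e_0 power_mult divide_simps)
        (simp add: algebra_simps)
    finally show ?thesis .
  qed
  \<comment> \<open>The scaled bound converges to \<open>R\<close> because \<rho> < 1, so its limsup
    is a limit that dominates \<open>robustness\<close>.\<close>
  define b where "b k = 1 / \<sigma>\<^sup>2 *
    (\<rho> ^ (2 * k) * (L / 2 * (norm (x0 - xs))\<^sup>2) + (1 - \<rho> ^ (2 * k)) * \<sigma>\<^sup>2 * R)" for k
  have "(\<lambda>k. \<rho> ^ (2 * k)) \<longlonglongrightarrow> 0"
    unfolding power_mult using \<rho>2 by (intro LIMSEQ_realpow_zero)
  then have "b \<longlonglongrightarrow> 1 / \<sigma>\<^sup>2 * (0 * (L / 2 * (norm (x0 - xs))\<^sup>2) + (1 - 0) * \<sigma>\<^sup>2 * R)"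
    unfolding b_def by (intro tendsto_intros)
  then have "b \<longlonglongrightarrow> R"
    using \<open>0 < \<sigma>\<close> by simp
  then have lim: "limsup (\<lambda>k. ereal (b k)) = ereal R"
    by (intro lim_imp_Limsup) auto
  have "1 / \<sigma>\<^sup>2 * (LINT \<omega>|M. f (x k \<omega>) - f xs) \<le> b k" for k
    unfolding b_def by (rule mult_left_mono[OF bound]) simp
  then have "robustness M \<sigma> f xs x \<le> limsup (\<lambda>k. ereal (b k))"
    unfolding robustness_def
    by (intro Limsup_mono always_eventually allI) (simp only: ereal_less_eq)
  then show ?thesis
    unfolding lim using gap_int bound by (auto simp only: \<rho>_def R_def)
qed

end
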